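(* Let $\bar X,\bar Z\in\mathbb S^n_+$ satisfy $\langle\bar X,\bar Z\rangle=0$. Let $l:\mathbb S^n\to\mathbb R\cup\{+\infty\}$ be either the indicator function $l=\delta_{\mathbb S^n_+}$ or the penalty function $l(X)=\rho\max\{0,\lambda_{\max}(-X)\}$ with $\rho>\mathrm{tr}(\bar Z)$. Then $$(\partial l)^{-1}(-\bar Z)=(\partial\delta_{\mathbb S^n_+})^{-1}(-\bar Z)=\mathcal N_{(\mathbb S^n_+)^\circ}(-\bar Z).$$ Moreover, for any $\mu\in(0,\infty)$ there exists a constant $\kappa>0$ such that $$l(X)\ \ge\ l(\bar X)+\langle-\bar Z,X-\bar X\rangle+\kappa\cdot\mathrm{dist}^2\big(X,(\partial l)^{-1}(-\bar Z)\big),\qquad\forall X\in\mathbb B(\bar X,\mu).$$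
   Context: $\mathbb S^n$ is the space of real symmetric $n\times n$ matrices with $\langle X,Y\rangle=\mathrm{tr}(XY)$ and Frobenius norm $\|\cdot\|$; $\mathbb S^n_+$ is the positive semidefinite cone, $(\mathbb S^n_+)^\circ=-\mathbb S^n_+$ its polar cone; $\mathcal N_K(\cdot)$ is the normal cone of the convex set $K$; $\delta_S$ is the indicator function of $S$; $\partial l$ is the convex subdifferential and $(\partial l)^{-1}(V)=\{X\in\mathbb S^n\mid V\in\partial l(X)\}$; $\mathbb B(\bar X,\mu)=\{X\in\mathbb S^n\mid\|X-\bar X\|\le\mu\}$; $\mathrm{dist}$ is the Frobenius distance. *)

theory Defs
  imports "HOL-Analysis.Analysis"
begin

text \<open>The space of real symmetric matrices is the subset \<open>sym_mats\<close> of \<open>real^'n^'n\<close>; the order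
  of the matrices is \<open>CARD('n)\<close>. The library inner product, norm and distance of \<open>real^'n^'n\<close> are the
  entrywise (Frobenius) ones, and on \<open>sym_mats\<close> the inner product is the trace of the matrix product.
  Subdifferentials, polar and normal cones are all taken relative to \<open>sym_mats\<close>.\<close>

definition sym_mats :: "(real^'n^'n) set" where
  "sym_mats = {X. transpose X = X}"

lemma inner_sym_eq_trace:
  fixes X Y :: "real^'n^'n"
  assumes "X \<in> sym_mats"
  shows "X \<bullet> Y = trace (X ** Y)"
proof -
  have X: "X $ i $ j = X $ j $ i" for i j
    using assms by (metis (mono_tags) mem_Collect_eq sym_mats_def transpose_def vec_lambda_beta)
  have "X \<bullet> Y = (\<Sum>i\<in>UNIV. \<Sum>j\<in>UNIV. X $ j $ i * Y $ i $ j)"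
    by (simp add: inner_vec_def X)
  also have "\<dots> = trace (X ** Y)"
    unfolding trace_def matrix_matrix_mult_def by (simp add: sum.swap[of "\<lambda>i j. X $ j $ i * Y $ i $ j"])
  finally show ?thesis .
qed

definition psd_cone :: "(real^'n^'n) set" where
  "psd_cone = {X \<in> sym_mats. \<forall>v. 0 \<le> v \<bullet> (X *v v)}"

definition polar_cone :: "(real^'n^'n) set \<Rightarrow> (real^'n^'n) set" where
  "polar_cone K = {Y \<in> sym_mats. \<forall>X\<in>K. Y \<bullet> X \<le> 0}"

definition normal_cone :: "(real^'n^'n) set \<Rightarrow> real^'n^'n \<Rightarrow> (real^'n^'n) set" where
  "normal_cone K X = (if X \<in> K then {V \<in> sym_mats. \<forall>Y\<in>K. V \<bullet> (Y - X) \<le> 0} else {})"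

definition indicator_fun :: "(real^'n^'n) set \<Rightarrow> real^'n^'n \<Rightarrow> ereal" where
  "indicator_fun S X = (if X \<in> S then 0 else \<infinity>)"

text \<open>Extended-real-valued functions on \<open>sym_mats\<close> are functions on all of \<open>real^'n^'n\<close> whose values
  outside \<open>sym_mats\<close> are never used. The subdifferential is empty where the function is not finite.\<close>

definition subdiff :: "(real^'n^'n \<Rightarrow> ereal) \<Rightarrow> real^'n^'n \<Rightarrow> (real^'n^'n) set" where
  "subdiff f X = {V \<in> sym_mats. \<bar>f X\<bar> \<noteq> \<infinity> \<and> (\<forall>Y\<in>sym_mats. f X + ereal (V \<bullet> (Y - X)) \<le> f Y)}"

definition subdiff_inv :: "(real^'n^'n \<Rightarrow> ereal) \<Rightarrow> real^'n^'n \<Rightarrow> (real^'n^'n) set" where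
  "subdiff_inv f V = {X \<in> sym_mats. V \<in> subdiff f X}"

text \<open>Only applied to symmetric matrices, whose set of real eigenvalues is finite and nonempty.\<close>

definition lambda_max :: "real^'n^'n \<Rightarrow> real" where
  "lambda_max A = Max {c. \<exists>v. v \<noteq> 0 \<and> A *v v = c *\<^sub>R v}"

definition penalty_fun :: "real \<Rightarrow> real^'n^'n \<Rightarrow> ereal" where
  "penalty_fun \<rho> X = ereal (\<rho> * max 0 (lambda_max (- X)))"

end

theory Submission
  imports Defs
begin

text \<open>
  Let \<open>F\<close> be the set of positive semidefinite \<open>X\<close> with \<open>X \<bullet> Zbar = 0\<close>. Because the cone is
  self-dual, the inverse subdifferential of its indicator and the normal cone of its polar both
  equal \<open>F\<close>. For the penalty function, let \<open>t\<close> be the least nonnegative number such that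
  \<open>Y = X + t I\<close> is positive semidefinite; then the penalty at \<open>X\<close> is \<open>\<rho> t\<close>, and
  \<open>\<rho> t + Zbar \<bullet> X = (\<rho> - trace Zbar) t + Zbar \<bullet> Y\<close>, a sum of two nonnegative
  terms. It vanishes exactly when \<open>t = 0\<close> and \<open>X \<in> F\<close>, so the inverse subdifferential is again \<open>F\<close>.

  The growth condition follows from the same identity once each term is compared with a squared
  distance. On a ball, \<open>t\<^sup>2\<close> is at most a constant times \<open>t\<close>, and \<open>t\<close> controls the distance from \<open>X\<close>
  to \<open>Y\<close>. To bound the distance from a positive semidefinite \<open>Y\<close> to \<open>F\<close>, let \<open>Q\<close> be the orthogonal
  projection onto the range of \<open>Zbar\<close> and compare \<open>Y\<close> with \<open>(I - Q) Y (I - Q) \<in> F\<close>. The difference has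
  norm at most \<open>2 \<parallel>Y Q\<parallel>\<close>, and \<open>\<parallel>Y Q\<parallel>\<^sup>2 = Y\<^sup>2 \<bullet> Q \<le> \<parallel>Y\<parallel> (Y \<bullet> Q) \<le> (\<parallel>Y\<parallel> / c) (Y \<bullet> Zbar)\<close>, where \<open>c > 0\<close> is
  such that \<open>Zbar - c Q\<close> is positive semidefinite. The exponent two of the growth condition
  comes from this estimate, \<open>infdist_complementary_face_le\<close>.

  Since the penalty function lies below the indicator function and the inverse subdifferentials
  coincide, growth of the penalty function implies growth of the indicator function.

  Self-duality is proved by splitting off rank-one matrices one at a time, and the bound of \<open>Y\<^sup>2\<close> by a
  multiple of \<open>Y\<close> is the Cauchy-Schwarz inequality for the form of \<open>Y\<close>.
\<close>

section \<open>Symmetric matrices and the Frobenius inner product\<close>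

lemma sym_mats_iff_self_adjoint:
  fixes A :: "real^'n^'n"
  shows "A \<in> sym_mats \<longleftrightarrow> (\<forall>v w. v \<bullet> (A *v w) = (A *v v) \<bullet> w)"
proof
  assume "A \<in> sym_mats"
  then have "transpose A = A" by (simp add: sym_mats_def)
  then show "\<forall>v w. v \<bullet> (A *v w) = (A *v v) \<bullet> w"
    by (metis dot_lmul_matrix transpose_matrix_vector)
next
  assume *: "\<forall>v w. v \<bullet> (A *v w) = (A *v v) \<bullet> w"
  have "A $ i $ j = A $ j $ i" for i j
    using *[rule_format, of "axis i 1" "axis j 1"]
    by (simp add: inner_axis inner_axis' matrix_vector_mult_basis column_def)
  then show "A \<in> sym_mats"
    by (simp add: sym_mats_def transpose_def vec_eq_iff)
qed

lemma sym_mats_self_adjoint: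
  assumes "A \<in> sym_mats"
  shows "v \<bullet> (A *v w) = (A *v v) \<bullet> w"
  using assms sym_mats_iff_self_adjoint by blast

lemma subspace_sym_mats: "subspace sym_mats"
  by (auto simp: subspace_def sym_mats_def transpose_def vec_eq_iff)

lemma mat_1_in_sym_mats: "mat 1 \<in> sym_mats"
  by (simp add: sym_mats_def)

lemma square_in_sym_mats: "A \<in> sym_mats \<Longrightarrow> A ** A \<in> sym_mats"
  by (simp add: sym_mats_def matrix_transpose_mul)

lemma matrix_mult_diff_left:
  fixes A B :: "real^'n^'m" and C :: "real^'k^'n"
  shows "(A - B) ** C = A ** C - B ** C"
  by (simp add: matrix_matrix_mult_def vec_eq_iff sum_subtractf left_diff_distrib)

lemma matrix_mult_diff_right:
  fixes A :: "real^'n^'m" and B C :: "real^'k^'n"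
  shows "A ** (B - C) = A ** B - A ** C"
  by (simp add: matrix_matrix_mult_def vec_eq_iff sum_subtractf right_diff_distrib)

lemma inner_matrix_mult_left:
  fixes A :: "real^'n^'m" and B :: "real^'k^'n" and C :: "real^'k^'m"
  shows "(A ** B) \<bullet> C = B \<bullet> (transpose A ** C)"
proof -
  have "(A ** B) \<bullet> C = (\<Sum>i\<in>UNIV. \<Sum>j\<in>UNIV. \<Sum>k\<in>UNIV. A$i$k * B$k$j * C$i$j)"
    by (simp add: inner_vec_def matrix_matrix_mult_def sum_distrib_right)
  also have "\<dots> = (\<Sum>i\<in>UNIV. \<Sum>k\<in>UNIV. \<Sum>j\<in>UNIV. A$i$k * B$k$j * C$i$j)"
    by (intro sum.cong refl sum.swap)
  also have "\<dots> = (\<Sum>k\<in>UNIV. \<Sum>i\<in>UNIV. \<Sum>j\<in>UNIV. A$i$k * B$k$j * C$i$j)"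
    by (rule sum.swap)
  also have "\<dots> = (\<Sum>k\<in>UNIV. \<Sum>j\<in>UNIV. \<Sum>i\<in>UNIV. A$i$k * B$k$j * C$i$j)"
    by (intro sum.cong refl sum.swap)
  also have "\<dots> = B \<bullet> (transpose A ** C)"
    by (simp add: inner_vec_def matrix_matrix_mult_def transpose_def sum_distrib_left mult_ac)
  finally show ?thesis .
qed

lemma inner_transpose:
  fixes A B :: "real^'n^'m"
  shows "transpose A \<bullet> transpose B = A \<bullet> B"
  by (simp add: inner_vec_def transpose_def) (rule sum.swap)

lemma norm_transpose:
  fixes A :: "real^'n^'m"
  shows "norm (transpose A) = norm A"
  by (simp only: norm_eq_sqrt_inner inner_transpose)

lemma inner_matrix_mult_right:
  fixes A :: "real^'n^'m" and B :: "real^'k^'n" and C :: "real^'k^'m"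
  shows "(A ** B) \<bullet> C = A \<bullet> (C ** transpose B)"
proof -
  have "(A ** B) \<bullet> C = (transpose B ** transpose A) \<bullet> transpose C"
    unfolding matrix_transpose_mul[symmetric] by (rule inner_transpose[symmetric])
  also have "\<dots> = transpose A \<bullet> transpose (C ** transpose B)"
    by (simp only: inner_matrix_mult_left matrix_transpose_mul)
  finally show ?thesis by (simp only: inner_transpose)
qed

lemma norm_matrix_vector_mult_le:
  fixes A :: "real^'n^'m"
  shows "norm (A *v v) \<le> norm A * norm v"
proof -
  have "(A *v v) $ i = A $ i \<bullet> v" for i
    by (simp add: matrix_vector_mult_def inner_vec_def)
  then have "norm (A *v v) \<le> L2_set (\<lambda>i. norm (A $ i) * norm v) UNIV"
    unfolding norm_vec_def[of "A *v v"]
    by (intro L2_set_mono) (simp_all add: Cauchy_Schwarz_ineq2)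
  also have "\<dots> = norm A * norm v"
    by (simp add: norm_vec_def[of A] L2_set_left_distrib)
  finally show ?thesis .
qed

text \<open>The rows of \<open>A ** P\<close> are the images under \<open>P\<close> of the rows of \<open>A\<close>, and the square of the Frobenius
  norm is the sum of the squared norms of the rows.\<close>

lemma norm_mult_contraction_le:
  fixes A P :: "real^'n^'n"
  assumes "P \<in> sym_mats" and "\<And>v. norm (P *v v) \<le> norm v"
  shows "norm (A ** P) \<le> norm A"
proof -
  have "(A ** P) $ i = P *v (A $ i)" for i
  proof -
    have "P $ k $ j = P $ j $ k" for j k
      using assms(1) by (metis (mono_tags) mem_Collect_eq sym_mats_def transpose_def vec_lambda_beta)
    then show ?thesis
      by (simp add: vec_eq_iff matrix_matrix_mult_def matrix_vector_mult_def mult.commute)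
  qed
  then show ?thesis
    unfolding norm_vec_def[of "A ** P"] norm_vec_def[of A]
    by (intro L2_set_mono) (auto simp: assms(2))
qed

section \<open>Positive semidefinite matrices\<close>

lemma psd_coneI: "A \<in> sym_mats \<Longrightarrow> (\<And>v. 0 \<le> v \<bullet> (A *v v)) \<Longrightarrow> A \<in> psd_cone"
  by (simp add: psd_cone_def)

lemma psd_cone_sym: "A \<in> psd_cone \<Longrightarrow> A \<in> sym_mats"
  by (simp add: psd_cone_def)

lemma psd_cone_form_nonneg: "A \<in> psd_cone \<Longrightarrow> 0 \<le> v \<bullet> (A *v v)"
  by (simp add: psd_cone_def)

lemma psd_cone_scaleR:
  fixes A :: "real^'n^'n"
  assumes "A \<in> psd_cone" "0 \<le> c" shows "c *\<^sub>R A \<in> psd_cone"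
proof (rule psd_coneI)
  show "c *\<^sub>R A \<in> sym_mats"
    using assms subspace_scale[OF subspace_sym_mats] psd_cone_sym by blast
  show "0 \<le> v \<bullet> (c *\<^sub>R A *v v)" for v
    using assms psd_cone_form_nonneg[of A v] by (simp flip: scaleR_matrix_vector_assoc)
qed

lemma mat_1_in_psd_cone: "(mat 1 :: real^'n^'n) \<in> psd_cone"
  by (intro psd_coneI mat_1_in_sym_mats) simp

lemma zero_in_psd_cone: "(0 :: real^'n^'n) \<in> psd_cone"
  using psd_cone_scaleR[OF mat_1_in_psd_cone, of 0] by simp

text \<open>The form may be degenerate: at a null vector \<open>v\<close> the form at \<open>w + t v\<close> is affine in \<open>t\<close>, so its
  slope must vanish.\<close>

lemma psd_cone_Cauchy_Schwarz:
  fixes A :: "real^'n^'n"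
  assumes "A \<in> psd_cone"
  shows "(w \<bullet> (A *v v))\<^sup>2 \<le> (w \<bullet> (A *v w)) * (v \<bullet> (A *v v))"
proof -
  define a b c where "a = v \<bullet> (A *v v)" and "b = w \<bullet> (A *v v)" and "c = w \<bullet> (A *v w)"
  have vw: "v \<bullet> (A *v w) = b"
    using sym_mats_self_adjoint[OF psd_cone_sym[OF assms], of v w] by (simp add: b_def inner_commute)
  have form: "0 \<le> s\<^sup>2 * c + 2 * s * t * b + t\<^sup>2 * a" for s t
  proof -
    have "0 \<le> (s *\<^sub>R w + t *\<^sub>R v) \<bullet> (A *v (s *\<^sub>R w + t *\<^sub>R v))"
      by (rule psd_cone_form_nonneg[OF assms])
    also have "\<dots> = s\<^sup>2 * c + 2 * s * t * b + t\<^sup>2 * a"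
      using vw by (simp add: matrix_vector_right_distrib matrix_vector_mult_scaleR inner_add_left
          inner_add_right a_def b_def c_def power2_eq_square algebra_simps)
    finally show ?thesis .
  qed
  have a: "0 \<le> a" unfolding a_def by (rule psd_cone_form_nonneg[OF assms])
  have "b\<^sup>2 \<le> c * a"
  proof (cases "a = 0")
    case True
    have "b = 0"
    proof (rule ccontr)
      assume "b \<noteq> 0"
      then have "2 * (-(c + 1) / (2 * b)) * b = -(c + 1)" by simp
      with form[of 1 "-(c + 1) / (2 * b)"] True show False by simp
    qed
    then show ?thesis using True by simp
  next
    case False
    have "0 \<le> a * (c * a - b\<^sup>2)"
      using form[of a "-b"] by (simp add: power2_eq_square algebra_simps)
    then show ?thesis using a False by (simp add: zero_le_mult_iff)
  qed
  then show ?thesis by (simp add: a_def b_def c_def)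
qed

text \<open>This is the form of the matrix inequality \<open>A ** A \<le> norm A *\<^sub>R A\<close>. It is Cauchy-Schwarz for the
  form of \<open>A\<close> at the vectors \<open>A *v v\<close> and \<open>v\<close>.\<close>

lemma psd_cone_norm_image_le:
  fixes A :: "real^'n^'n"
  assumes "A \<in> psd_cone"
  shows "(norm (A *v v))\<^sup>2 \<le> norm A * (v \<bullet> (A *v v))"
proof (cases "A *v v = 0")
  case False
  let ?w = "A *v v"
  have "(norm ?w)\<^sup>2 * (norm ?w)\<^sup>2 = (?w \<bullet> ?w)\<^sup>2"
    by (simp flip: power2_norm_eq_inner power_mult add: power2_eq_square)
  also have "\<dots> \<le> (?w \<bullet> (A *v ?w)) * (v \<bullet> (A *v v))"
    by (rule psd_cone_Cauchy_Schwarz[OF assms])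
  also have "?w \<bullet> (A *v ?w) \<le> norm ?w * (norm A * norm ?w)"
    by (rule order_trans[OF norm_cauchy_schwarz mult_left_mono[OF norm_matrix_vector_mult_le]]) simp
  finally have "(norm ?w)\<^sup>2 * (norm ?w)\<^sup>2 \<le> (norm ?w)\<^sup>2 * (norm A * (v \<bullet> (A *v v)))"
    using psd_cone_form_nonneg[OF assms, of v]
    by (simp add: mult_right_mono power2_eq_square mult_ac)
  moreover have "0 < (norm ?w)\<^sup>2" using False by simp
  ultimately show ?thesis by (simp only: mult_le_cancel_left_pos)
qed simp

lemma psd_cone_form_eq_0_imp_kernel:
  fixes A :: "real^'n^'n"
  assumes "A \<in> psd_cone" "v \<bullet> (A *v v) = 0"
  shows "A *v v = 0"
  using psd_cone_norm_image_le[OF assms(1), of v] assms(2) by simp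

definition outer_square :: "real^'n \<Rightarrow> real^'n^'n" where
  "outer_square b = (\<chi> i j. b $ i * b $ j)"

lemma outer_square_mult_vec: "outer_square b *v v = (b \<bullet> v) *\<^sub>R b"
  by (simp add: outer_square_def vec_eq_iff matrix_vector_mult_def inner_vec_def sum_distrib_left mult_ac)

lemma inner_outer_square: "A \<bullet> outer_square b = b \<bullet> (A *v b)"
  by (simp add: outer_square_def matrix_vector_mult_def inner_vec_def sum_distrib_left mult_ac)

lemma outer_square_in_psd_cone: "outer_square b \<in> psd_cone"
  by (rule psd_coneI)
    (auto simp: outer_square_mult_vec sym_mats_iff_self_adjoint inner_commute)

text \<open>If \<open>v\<close> has a positive value under the form of \<open>B\<close>, then subtracting from \<open>B\<close> the outer square of
  \<open>B *v v\<close>, divided by that value, leaves a positive semidefinite matrix: this is Cauchy-Schwarz for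
  \<open>B\<close>. Its kernel is larger, as it contains the kernel of \<open>B\<close> and also \<open>v\<close>. So \<open>B\<close> is a finite sum of
  outer squares, and against an outer square \<open>A\<close> gives a value of its form.\<close>

lemma psd_cone_inner_nonneg:
  fixes A B :: "real^'n^'n"
  assumes "A \<in> psd_cone" "B \<in> psd_cone"
  shows "0 \<le> A \<bullet> B"
  using assms(2)
proof (induction "CARD('n) - dim {v. B *v v = 0}" arbitrary: B rule: less_induct)
  case less
  note B = less.prems
  let ?K = "\<lambda>M. {v :: real^'n. M *v v = 0}"
  have ker: "subspace (?K M)" for M :: "real^'n^'n"
    by (auto simp: subspace_def matrix_vector_right_distrib matrix_vector_mult_scaleR)
  show ?case
  proof (cases "\<exists>v. v \<bullet> (B *v v) \<noteq> 0")
    case False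
    then have "B *v v = 0" for v using psd_cone_form_eq_0_imp_kernel[OF B] by blast
    then have "B = 0" by (simp add: matrix_eq)
    then show ?thesis by simp
  next
    case True
    then obtain v where v: "v \<bullet> (B *v v) > 0"
      using psd_cone_form_nonneg[OF B] by (metis order_le_less)
    let ?b = "B *v v" and ?r = "inverse (v \<bullet> (B *v v))"
    define C where "C = B - ?r *\<^sub>R outer_square ?b"
    have Cw: "C *v w = B *v w - (?r * (?b \<bullet> w)) *\<^sub>R ?b" for w
      by (simp add: C_def matrix_vector_mult_diff_rdistrib outer_square_mult_vec
          flip: scaleR_matrix_vector_assoc)
    have bw: "?b \<bullet> w = v \<bullet> (B *v w)" for w
      using sym_mats_self_adjoint[OF psd_cone_sym[OF B]] by metis
    have C: "C \<in> psd_cone"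
    proof (rule psd_coneI)
      show "C \<in> sym_mats"
        unfolding C_def
        by (intro subspace_diff subspace_scale subspace_sym_mats psd_cone_sym B outer_square_in_psd_cone)
      fix w
      have "(w \<bullet> ?b)\<^sup>2 * ?r \<le> w \<bullet> (B *v w)"
        using psd_cone_Cauchy_Schwarz[OF B, of w v] v by (simp add: field_simps)
      then show "0 \<le> w \<bullet> (C *v w)"
        by (simp add: Cw inner_diff_right inner_commute power2_eq_square mult_ac)
    qed
    have "?K B \<subseteq> ?K C" by (auto simp: Cw bw)
    moreover have "v \<in> ?K C" using v by (simp add: Cw inner_commute)
    moreover have "v \<notin> ?K B" using v by auto
    ultimately have "?K B \<subset> ?K C" by blast
    then have "dim (?K B) < dim (?K C)"
      by (intro dim_psubset) (simp add: span_eq_iff[THEN iffD2] ker)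
    moreover have "dim (?K C) \<le> CARD('n)"
      using dim_subset_UNIV[of "?K C"] by simp
    ultimately have "0 \<le> A \<bullet> C" using less.hyps[OF _ C] by simp
    moreover have "0 \<le> A \<bullet> outer_square ?b"
      unfolding inner_outer_square by (rule psd_cone_form_nonneg[OF assms(1)])
    moreover have "A \<bullet> B = A \<bullet> C + ?r * (A \<bullet> outer_square ?b)"
      by (simp add: C_def inner_diff_right)
    ultimately show ?thesis using v by simp
  qed
qed

lemma sym_inner_nonneg_imp_psd:
  fixes A :: "real^'n^'n"
  assumes "A \<in> sym_mats" "\<And>B. B \<in> psd_cone \<Longrightarrow> 0 \<le> A \<bullet> B"
  shows "A \<in> psd_cone"
  using assms(2)[OF outer_square_in_psd_cone] by (intro psd_coneI assms(1)) (simp add: inner_outer_square)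

lemma polar_psd_cone: "polar_cone psd_cone = uminus ` (psd_cone :: (real^'n^'n) set)"
proof safe
  fix Y :: "real^'n^'n" assume Y: "Y \<in> polar_cone psd_cone"
  have "- Y \<in> psd_cone"
    using Y subspace_neg[OF subspace_sym_mats]
    by (intro sym_inner_nonneg_imp_psd) (auto simp: polar_cone_def)
  then show "Y \<in> uminus ` psd_cone" by (metis imageI minus_minus)
next
  fix Y :: "real^'n^'n" assume "Y \<in> psd_cone"
  then show "- Y \<in> polar_cone psd_cone"
    using psd_cone_inner_nonneg subspace_neg[OF subspace_sym_mats] psd_cone_sym
    by (auto simp: polar_cone_def)
qed

section \<open>The largest eigenvalue and the distance to the cone along the identity\<close>

text \<open>Eigenvectors of distinct eigenvalues are orthogonal, and an orthogonal set is finite. Finiteness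
  is what gives the \<open>Max\<close> in \<open>lambda_max\<close> its meaning.\<close>

lemma finite_eigenvalues_sym:
  fixes A :: "real^'n^'n"
  assumes "A \<in> sym_mats"
  shows "finite {c. \<exists>v. v \<noteq> 0 \<and> A *v v = c *\<^sub>R v}" (is "finite ?E")
proof -
  define e where "e c = (SOME v. v \<noteq> 0 \<and> A *v v = c *\<^sub>R v)" for c
  have e: "e c \<noteq> 0 \<and> A *v e c = c *\<^sub>R e c" if "c \<in> ?E" for c
    using that unfolding e_def mem_Collect_eq by (rule someI_ex)
  then have e_nonzero: "e c \<noteq> 0" and e_eigen: "A *v e c = c *\<^sub>R e c" if "c \<in> ?E" for c
    using that by blast+
  have orth: "e c \<bullet> e d = 0" if "c \<in> ?E" "d \<in> ?E" "c \<noteq> d" for c d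
  proof -
    have "d * (e c \<bullet> e d) = c * (e c \<bullet> e d)"
      using sym_mats_self_adjoint[OF assms, of "e c" "e d"]
      unfolding e_eigen[OF that(1)] e_eigen[OF that(2)] by simp
    then show ?thesis using that by simp
  qed
  have inj: "inj_on e ?E"
  proof (rule inj_onI, rule ccontr)
    fix c d assume cd: "c \<in> ?E" "d \<in> ?E" and eq: "e c = e d" and ne: "c \<noteq> d"
    have "e c \<bullet> e c = 0" using orth[OF cd ne] unfolding eq .
    then show False using e_nonzero[OF cd(1)] unfolding inner_eq_zero_iff by contradiction
  qed
  have "pairwise orthogonal (e ` ?E)"
  proof (rule pairwiseI)
    fix x y assume "x \<in> e ` ?E" "y \<in> e ` ?E" and "x \<noteq> y"
    then obtain c d where cd: "c \<in> ?E" "d \<in> ?E" and xy: "x = e c" "y = e d" by (elim imageE)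
    then have "c \<noteq> d" using \<open>x \<noteq> y\<close> by metis
    then show "orthogonal x y" unfolding xy orthogonal_def by (rule orth[OF cd])
  qed
  then have "finite (e ` ?E)" by (rule pairwise_orthogonal_imp_finite)
  then show ?thesis using inj by (rule finite_imageD)
qed

text \<open>A maximizer \<open>v\<close> of the form over the unit sphere, with value \<open>m\<close>, is a null vector of the positive
  semidefinite form of \<open>m I - A\<close>. It therefore lies in the kernel of \<open>m I - A\<close>, so \<open>m\<close> is an
  eigenvalue; no eigenvalue is larger, since each is a value of the form at a unit vector.\<close>

lemma lambda_max_sym:
  fixes A :: "real^'n^'n"
  assumes "A \<in> sym_mats"
  shows "lambda_max A *\<^sub>R mat 1 - A \<in> psd_cone"
    and "\<exists>v. v \<noteq> 0 \<and> A *v v = lambda_max A *\<^sub>R v"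
proof -
  let ?E = "{c. \<exists>v. v \<noteq> 0 \<and> A *v v = c *\<^sub>R v}"
  have "\<exists>v\<in>sphere 0 1. \<forall>w\<in>sphere 0 1. w \<bullet> (A *v w) \<le> v \<bullet> (A *v v)"
    by (intro continuous_attains_sup continuous_intros compact_sphere
        linear_continuous_on_compose matrix_vector_mul_linear) simp
  then obtain v where v: "norm v = 1"
    and max: "\<And>w. norm w = 1 \<Longrightarrow> w \<bullet> (A *v w) \<le> v \<bullet> (A *v v)" by auto
  define m where "m = v \<bullet> (A *v v)"
  have form: "w \<bullet> ((m *\<^sub>R mat 1 - A) *v w) = m * (w \<bullet> w) - w \<bullet> (A *v w)" for w
    by (simp add: matrix_vector_mult_diff_rdistrib inner_diff_right flip: scaleR_matrix_vector_assoc)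
  have psd: "m *\<^sub>R mat 1 - A \<in> psd_cone"
  proof (rule psd_coneI)
    show "m *\<^sub>R mat 1 - A \<in> sym_mats"
      by (intro subspace_diff subspace_scale subspace_sym_mats mat_1_in_sym_mats assms)
    fix w :: "real^'n"
    show "0 \<le> w \<bullet> ((m *\<^sub>R mat 1 - A) *v w)"
    proof (cases "w = 0")
      case False
      define u where "u = w /\<^sub>R norm w"
      have w: "w = norm w *\<^sub>R u" "norm u = 1" using False by (simp_all add: u_def)
      have "w \<bullet> (A *v w) = (norm w)\<^sup>2 * (u \<bullet> (A *v u))"
        by (subst (1 2) w(1)) (simp add: matrix_vector_mult_scaleR power2_eq_square)
      also have "\<dots> \<le> (norm w)\<^sup>2 * m"
        unfolding m_def by (intro mult_left_mono max w) simp
      finally show ?thesis unfolding form by (simp add: power2_norm_eq_inner mult.commute)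
    qed simp
  qed
  have "(m *\<^sub>R mat 1 - A) *v v = 0"
  proof (rule psd_cone_form_eq_0_imp_kernel[OF psd])
    show "v \<bullet> ((m *\<^sub>R mat 1 - A) *v v) = 0"
      unfolding form using v by (simp add: m_def flip: power2_norm_eq_inner)
  qed
  then have mE: "m \<in> ?E"
    using v by (auto simp: matrix_vector_mult_diff_rdistrib simp flip: scaleR_matrix_vector_assoc
        intro!: exI[of _ v])
  have "c \<le> m" if cE: "c \<in> ?E" for c
  proof -
    obtain w where w: "w \<noteq> 0" "A *v w = c *\<^sub>R w" using cE by blast
    have "0 \<le> (m - c) * (w \<bullet> w)"
      using psd_cone_form_nonneg[OF psd, of w] unfolding form w(2) by (simp add: algebra_simps)
    moreover have "0 < w \<bullet> w" using w(1) by simp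
    ultimately show ?thesis by (simp add: zero_le_mult_iff)
  qed
  then have eq: "lambda_max A = m"
    unfolding lambda_max_def by (intro Max_eqI finite_eigenvalues_sym[OF assms] mE)
  show "lambda_max A *\<^sub>R mat 1 - A \<in> psd_cone"
    unfolding eq by (rule psd)
  show "\<exists>v. v \<noteq> 0 \<and> A *v v = lambda_max A *\<^sub>R v"
    using mE unfolding eq mem_Collect_eq .
qed

text \<open>The least \<open>t \<ge> 0\<close> for which \<open>X + t I\<close> is positive semidefinite, when \<open>X\<close> is symmetric.\<close>

definition psd_deficit :: "real^'n^'n \<Rightarrow> real" where
  "psd_deficit X = max 0 (lambda_max (- X))"

lemma penalty_fun_eq_deficit: "penalty_fun \<rho> X = ereal (\<rho> * psd_deficit X)"
  by (simp add: penalty_fun_def psd_deficit_def)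

lemma psd_deficit_nonneg: "0 \<le> psd_deficit X"
  by (simp add: psd_deficit_def)

lemma psd_deficit_le_norm:
  fixes X :: "real^'n^'n"
  assumes "X \<in> sym_mats"
  shows "psd_deficit X \<le> norm X"
proof -
  obtain v where v: "v \<noteq> 0" "(- X) *v v = lambda_max (- X) *\<^sub>R v"
    using lambda_max_sym(2) subspace_neg[OF subspace_sym_mats assms] by blast
  have "\<bar>lambda_max (- X)\<bar> * norm v \<le> norm X * norm v"
    using norm_matrix_vector_mult_le[of "- X" v] v(2) by simp
  then show ?thesis using v(1) by (simp add: psd_deficit_def)
qed

lemma shift_by_deficit_psd:
  fixes X :: "real^'n^'n"
  assumes "X \<in> sym_mats"
  shows "X + psd_deficit X *\<^sub>R mat 1 \<in> psd_cone"
proof (rule psd_coneI)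
  show "X + psd_deficit X *\<^sub>R mat 1 \<in> sym_mats"
    by (intro subspace_add subspace_scale subspace_sym_mats mat_1_in_sym_mats assms)
  fix v :: "real^'n"
  have "0 \<le> v \<bullet> ((lambda_max (- X) *\<^sub>R mat 1 - (- X)) *v v)"
    by (rule psd_cone_form_nonneg[OF lambda_max_sym(1)[OF subspace_neg[OF subspace_sym_mats assms]]])
  also have "\<dots> \<le> v \<bullet> ((X + psd_deficit X *\<^sub>R mat 1) *v v)"
    by (simp add: matrix_vector_mult_add_rdistrib inner_add_right psd_deficit_def mult_right_mono
        flip: scaleR_matrix_vector_assoc)
  finally show "0 \<le> v \<bullet> ((X + psd_deficit X *\<^sub>R mat 1) *v v)" .
qed

lemma psd_deficit_eq_0:
  fixes X :: "real^'n^'n"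
  assumes "X \<in> psd_cone"
  shows "psd_deficit X = 0"
proof -
  have "- X \<in> sym_mats" using assms psd_cone_sym subspace_neg[OF subspace_sym_mats] by blast
  then obtain v where v: "v \<noteq> 0" "(- X) *v v = lambda_max (- X) *\<^sub>R v"
    using lambda_max_sym(2) by blast
  have "lambda_max (- X) * (v \<bullet> v) = v \<bullet> ((- X) *v v)" using v(2) by simp
  also have "\<dots> = - (v \<bullet> (X *v v))"
    using matrix_vector_mult_diff_rdistrib[of 0 X v] by simp
  also have "\<dots> \<le> 0" using psd_cone_form_nonneg[OF assms] by simp
  finally have "lambda_max (- X) \<le> 0"
    using v(1) by (simp add: mult_le_0_iff flip: power2_norm_eq_inner)
  then show ?thesis by (simp add: psd_deficit_def)
qed

section \<open>The inverse subdifferentials\<close>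

text \<open>The face of the cone exposed by \<open>- Z\<close>, when \<open>Z\<close> is positive semidefinite.\<close>

definition complementary_face :: "real^'n^'n \<Rightarrow> (real^'n^'n) set" where
  "complementary_face Z = {X \<in> psd_cone. X \<bullet> Z = 0}"

text \<open>Testing the subgradient inequality at the origin already forces \<open>Z \<bullet> X \<le> 0\<close>.\<close>

lemma subdiff_inv_indicator_psd:
  fixes Z :: "real^'n^'n"
  assumes "Z \<in> psd_cone"
  shows "subdiff_inv (indicator_fun psd_cone) (- Z) = complementary_face Z"
proof (intro equalityI subsetI)
  fix X :: "real^'n^'n" assume X: "X \<in> subdiff_inv (indicator_fun psd_cone) (- Z)"
  then have X_psd: "X \<in> psd_cone"
    by (auto simp: subdiff_inv_def subdiff_def indicator_fun_def split: if_splits)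
  have "\<forall>Y\<in>sym_mats. indicator_fun psd_cone X + ereal ((- Z) \<bullet> (Y - X)) \<le> indicator_fun psd_cone Y"
    using X unfolding subdiff_inv_def subdiff_def mem_Collect_eq by (elim conjE)
  then have "indicator_fun psd_cone X + ereal ((- Z) \<bullet> (0 - X)) \<le> indicator_fun psd_cone (0 :: real^'n^'n)"
    by (rule bspec) (rule psd_cone_sym[OF zero_in_psd_cone])
  then have "Z \<bullet> X \<le> 0"
    using X_psd by (simp add: indicator_fun_def zero_in_psd_cone)
  then show "X \<in> complementary_face Z"
    using psd_cone_inner_nonneg[OF assms X_psd] X_psd
    by (simp add: complementary_face_def inner_commute)
next
  fix X :: "real^'n^'n" assume "X \<in> complementary_face Z"
  then have X: "X \<in> psd_cone" "Z \<bullet> X = 0"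
    by (simp_all add: complementary_face_def inner_commute)
  have "- Z \<in> sym_mats" using assms psd_cone_sym subspace_neg[OF subspace_sym_mats] by blast
  then show "X \<in> subdiff_inv (indicator_fun psd_cone) (- Z)"
    using X psd_cone_sym[OF X(1)] psd_cone_inner_nonneg[OF assms]
    by (auto simp: subdiff_inv_def subdiff_def indicator_fun_def inner_diff_right)
qed

text \<open>By self-duality the polar is the negative of the cone, so membership in the normal cone says that
  \<open>V \<bullet> W\<close> is minimal at \<open>W = Z\<close> over the cone. A linear function bounded below on a cone is nonnegative
  there, and its minimum is zero.\<close>

lemma normal_cone_polar_psd:
  fixes Z :: "real^'n^'n"
  assumes "Z \<in> psd_cone"
  shows "normal_cone (polar_cone psd_cone) (- Z) = complementary_face Z"
proof -
  have mem: "- Z \<in> polar_cone psd_cone" using assms by (simp add: polar_psd_cone)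
  have "V \<in> normal_cone (polar_cone psd_cone) (- Z) \<longleftrightarrow>
      V \<in> sym_mats \<and> (\<forall>W\<in>psd_cone. V \<bullet> (Z - W) \<le> 0)" for V
    unfolding normal_cone_def using mem by (simp add: polar_psd_cone)
  moreover have "V \<in> sym_mats \<and> (\<forall>W\<in>psd_cone. V \<bullet> (Z - W) \<le> 0) \<longleftrightarrow> V \<in> complementary_face Z" for V
  proof
    assume V: "V \<in> sym_mats \<and> (\<forall>W\<in>psd_cone. V \<bullet> (Z - W) \<le> 0)"
    have VW: "V \<bullet> Z \<le> V \<bullet> W" if "W \<in> psd_cone" for W
      using V that by (simp add: inner_diff_right)
    have "V \<bullet> Z \<le> 0" using VW[OF zero_in_psd_cone] by simp
    have "0 \<le> V \<bullet> W" if W: "W \<in> psd_cone" for W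
    proof (rule ccontr)
      assume neg: "\<not> 0 \<le> V \<bullet> W"
      \<comment> \<open>A multiple of \<open>W\<close> on which \<open>V\<close> takes a value below \<open>V \<bullet> Z\<close>.\<close>
      let ?c = "(V \<bullet> Z - 1) / (V \<bullet> W)"
      have "0 \<le> ?c" using neg \<open>V \<bullet> Z \<le> 0\<close> by (intro divide_nonpos_nonpos) auto
      from VW[OF psd_cone_scaleR[OF W this]] neg show False by simp
    qed
    then have "V \<in> psd_cone" using V by (blast intro: sym_inner_nonneg_imp_psd)
    then show "V \<in> complementary_face Z"
      using \<open>V \<bullet> Z \<le> 0\<close> psd_cone_inner_nonneg[OF _ assms] by (force simp: complementary_face_def)
  next
    assume "V \<in> complementary_face Z"
    then show "V \<in> sym_mats \<and> (\<forall>W\<in>psd_cone. V \<bullet> (Z - W) \<le> 0)"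
      using psd_cone_sym psd_cone_inner_nonneg by (auto simp: complementary_face_def inner_diff_right)
  qed
  ultimately show ?thesis by blast
qed

lemma inner_shift_by_deficit:
  fixes X Z :: "real^'n^'n"
  assumes "Z \<in> sym_mats"
  shows "Z \<bullet> (X + psd_deficit X *\<^sub>R mat 1) = Z \<bullet> X + psd_deficit X * trace Z"
  using inner_sym_eq_trace[OF assms, of "mat 1"] by (simp add: inner_add_right)

text \<open>If \<open>- Z\<close> is a subgradient at \<open>X\<close>, testing at the matrix \<open>X + t I\<close>, where the penalty vanishes, gives
  \<open>(\<rho> - trace Z) t \<le> 0\<close>, so \<open>X\<close> is positive semidefinite; testing at the origin then gives
  complementarity. Conversely, \<open>Z\<close> is nonnegative on the shift \<open>Y + t I\<close> of any symmetric \<open>Y\<close>,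
  and this is the subgradient inequality with \<open>trace Z\<close> in place of \<open>\<rho>\<close>.\<close>

lemma subdiff_inv_penalty:
  fixes Z :: "real^'n^'n"
  assumes Z: "Z \<in> psd_cone" and \<rho>: "\<rho> > trace Z"
  shows "subdiff_inv (penalty_fun \<rho>) (- Z) = complementary_face Z"
proof (intro equalityI subsetI)
  fix X :: "real^'n^'n" assume X: "X \<in> subdiff_inv (penalty_fun \<rho>) (- Z)"
  let ?t = "psd_deficit X" and ?Y = "X + psd_deficit X *\<^sub>R mat 1"
  have X_sym: "X \<in> sym_mats" using X by (simp add: subdiff_inv_def)
  have sub: "\<rho> * ?t - Z \<bullet> (Y - X) \<le> 0" if "Y \<in> psd_cone" for Y
    using X psd_cone_sym[OF that] psd_deficit_eq_0[OF that]
    by (fastforce simp: subdiff_inv_def subdiff_def penalty_fun_eq_deficit)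
  have "(\<rho> - trace Z) * ?t \<le> 0"
    using sub[OF shift_by_deficit_psd[OF X_sym]]
    unfolding inner_diff_right inner_shift_by_deficit[OF psd_cone_sym[OF Z]]
    by (simp add: algebra_simps)
  then have t: "?t = 0"
    using \<rho> psd_deficit_nonneg[of X] by (simp add: mult_le_0_iff)
  have X_psd: "X \<in> psd_cone" using shift_by_deficit_psd[OF X_sym] t by simp
  have "Z \<bullet> X \<le> 0" using sub[OF zero_in_psd_cone] t by simp
  then show "X \<in> complementary_face Z"
    using psd_cone_inner_nonneg[OF Z X_psd] X_psd by (simp add: complementary_face_def inner_commute)
next
  fix X :: "real^'n^'n" assume "X \<in> complementary_face Z"
  then have X: "X \<in> psd_cone" "Z \<bullet> X = 0"
    by (simp_all add: complementary_face_def inner_commute)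
  have "- (Z \<bullet> Y) \<le> \<rho> * psd_deficit Y" if Y: "Y \<in> sym_mats" for Y
  proof -
    have "0 \<le> Z \<bullet> Y + psd_deficit Y * trace Z"
      using psd_cone_inner_nonneg[OF Z shift_by_deficit_psd[OF Y]]
      unfolding inner_shift_by_deficit[OF psd_cone_sym[OF Z]] .
    moreover have "trace Z * psd_deficit Y \<le> \<rho> * psd_deficit Y"
      using \<rho> psd_deficit_nonneg by (intro mult_right_mono) auto
    ultimately show ?thesis by (simp add: mult.commute)
  qed
  moreover have "- Z \<in> sym_mats" using Z psd_cone_sym subspace_neg[OF subspace_sym_mats] by blast
  ultimately show "X \<in> subdiff_inv (penalty_fun \<rho>) (- Z)"
    using X psd_cone_sym[OF X(1)] psd_deficit_eq_0[OF X(1)]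
    by (simp add: subdiff_inv_def subdiff_def penalty_fun_eq_deficit inner_diff_right)
qed

section \<open>The error bound for the complementary face\<close>

text \<open>\<open>Q\<close> is the orthogonal projection onto the complement of the kernel of \<open>Z\<close>, built from an orthonormal
  basis. On that complement \<open>Z\<close> is injective, so \<open>norm (Z *v q)\<close> is at least a positive multiple \<open>e\<close> of
  \<open>norm q\<close>. The bound of \<open>norm (Z *v v)\<close> by the form of \<open>Z\<close> turns this into coercivity of the form.\<close>

lemma range_projection:
  fixes Z :: "real^'n^'n"
  assumes Z: "Z \<in> psd_cone"
  obtains Q c where "Q \<in> psd_cone" "Q ** Q = Q" "Z ** Q = Z" "c > 0" "Z - c *\<^sub>R Q \<in> psd_cone"
proof -
  let ?K = "{v. Z *v v = 0}"
  let ?R = "orthogonal_comp ?K"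
  have ker: "subspace ?K"
    by (auto simp: subspace_def matrix_vector_right_distrib matrix_vector_mult_scaleR)
  have R: "subspace ?R" by (rule subspace_orthogonal_comp)
  obtain B where B: "B \<subseteq> ?R" "pairwise orthogonal B" "\<And>b. b \<in> B \<Longrightarrow> norm b = 1"
      "independent B" "span B = ?R"
    using orthonormal_basis_subspace[OF R] by metis
  have fin: "finite B" using B(2) by (rule pairwise_orthogonal_imp_finite)
  define Q where "Q = (\<Sum>b\<in>B. outer_square b)"
  have Q_vec: "Q *v v = (\<Sum>b\<in>B. (b \<bullet> v) *\<^sub>R b)" for v
  proof -
    have "(\<Sum>b\<in>S. outer_square b) *v v = (\<Sum>b\<in>S. (b \<bullet> v) *\<^sub>R b)" if "finite S" for S
      using that by induction (simp_all add: matrix_vector_mult_add_rdistrib outer_square_mult_vec)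
    then show ?thesis unfolding Q_def using fin .
  qed
  have QR: "Q *v v \<in> ?R" for v
    unfolding Q_vec B(5)[symmetric] by (intro span_sum span_scale span_base)
  have Q_sym: "Q \<in> sym_mats"
    unfolding Q_def by (intro subspace_sum subspace_sym_mats psd_cone_sym outer_square_in_psd_cone)
  have ZQv: "Z *v (v - Q *v v) = 0" for v
  proof -
    have "b \<bullet> (v - Q *v v) = 0" if b: "b \<in> B" for b
    proof -
      have "b \<bullet> (Q *v v) = (\<Sum>a\<in>B. (a \<bullet> v) * (b \<bullet> a))"
        by (simp add: Q_vec inner_sum_right)
      also have "\<dots> = (\<Sum>a\<in>B. if a = b then b \<bullet> v else 0)"
        using B(2,3) b by (intro sum.cong refl)
          (auto simp: pairwise_def orthogonal_def norm_eq_1 inner_commute)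
      finally show ?thesis using b fin by (simp add: inner_diff_right)
    qed
    then have "\<forall>b\<in>B. orthogonal (v - Q *v v) b"
      unfolding orthogonal_def by (subst inner_commute) blast
    then have "\<forall>x\<in>?R. orthogonal x (v - Q *v v)"
      unfolding B(5)[symmetric] using orthogonal_to_span orthogonal_commute by blast
    then have "v - Q *v v \<in> orthogonal_comp ?R"
      unfolding orthogonal_comp_def by blast
    then show ?thesis using orthogonal_comp_self[OF ker] by simp
  qed
  then have ZQ: "Z ** Q = Z"
    by (simp add: matrix_eq matrix_vector_mul_assoc[symmetric] matrix_vector_mult_diff_distrib)
  have R_kernel: "q = 0" if "q \<in> ?R" "Z *v q = 0" for q
    using that by (auto simp: orthogonal_comp_def orthogonal_def)
  have "Q *v (v - Q *v v) = 0" for v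
  proof (rule R_kernel[OF QR])
    show "Z *v (Q *v (v - Q *v v)) = 0"
      using ZQv ZQ by (metis matrix_vector_mul_assoc)
  qed
  then have QQ: "Q ** Q = Q"
    by (simp add: matrix_eq matrix_vector_mul_assoc[symmetric] matrix_vector_mult_diff_distrib)
  have Q_form: "v \<bullet> (Q *v v) = (norm (Q *v v))\<^sup>2" for v
    using sym_mats_self_adjoint[OF Q_sym, of v "Q *v v"] QQ
    by (simp add: matrix_vector_mul_assoc power2_norm_eq_inner)
  have "Q \<in> psd_cone" by (intro psd_coneI Q_sym) (simp add: Q_form)
  obtain e where e: "e > 0" "\<And>q. q \<in> ?R \<Longrightarrow> e * norm q \<le> norm (Z *v q)"
    using injective_imp_isometric[OF closed_subspace[OF R] R, of "(*v) Z"] R_kernel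
      matrix_vector_mul_bounded_linear by blast
  \<comment> \<open>The summand 1 covers the case \<open>Z = 0\<close>.\<close>
  let ?c = "e\<^sup>2 / (norm Z + 1)"
  have Z1: "norm Z + 1 > 0" by (simp add: add_nonneg_pos)
  have c: "?c > 0" using e(1) Z1 by simp
  have "Z - ?c *\<^sub>R Q \<in> psd_cone"
  proof (rule psd_coneI)
    show "Z - ?c *\<^sub>R Q \<in> sym_mats"
      by (intro subspace_diff subspace_scale subspace_sym_mats psd_cone_sym Z Q_sym)
    fix v
    have "Z *v (Q *v v) = Z *v v" using ZQ by (simp add: matrix_vector_mul_assoc)
    then have "(e * norm (Q *v v))\<^sup>2 \<le> (norm (Z *v v))\<^sup>2"
      using e(2)[OF QR, of v] e(1) by (intro power_mono) auto
    also have "\<dots> \<le> norm Z * (v \<bullet> (Z *v v))"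
      by (rule psd_cone_norm_image_le[OF Z])
    also have "\<dots> \<le> (norm Z + 1) * (v \<bullet> (Z *v v))"
      using psd_cone_form_nonneg[OF Z, of v] by (intro mult_right_mono) auto
    finally have "?c * (norm (Q *v v))\<^sup>2 \<le> v \<bullet> (Z *v v)"
      using Z1 by (simp add: field_simps power_mult_distrib)
    then show "0 \<le> v \<bullet> ((Z - ?c *\<^sub>R Q) *v v)"
      by (simp add: matrix_vector_mult_diff_rdistrib inner_diff_right Q_form
          flip: scaleR_matrix_vector_assoc)
  qed
  with \<open>Q \<in> psd_cone\<close> QQ ZQ c show ?thesis using that by blast
qed

text \<open>The comparison point is \<open>P Y P\<close> with \<open>P = mat 1 - Q\<close>, and \<open>Y - P Y P = Y Q + Q Y P\<close>. The linear
  quantity \<open>Z \<bullet> Y\<close> bounds a squared distance because the off-diagonal block of a positive semidefinite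
  matrix is at most of the order of the square root of its diagonal block.\<close>

lemma infdist_complementary_face_le:
  fixes Z :: "real^'n^'n"
  assumes Z: "Z \<in> psd_cone"
  obtains C where "C > 0"
    "\<And>Y. Y \<in> psd_cone \<Longrightarrow> (infdist Y (complementary_face Z))\<^sup>2 \<le> C * norm Y * (Z \<bullet> Y)"
proof -
  obtain Q c where Q: "Q \<in> psd_cone" and QQ: "Q ** Q = Q" and ZQ: "Z ** Q = Z"
    and c: "c > 0" "Z - c *\<^sub>R Q \<in> psd_cone"
    using range_projection[OF Z] .
  have tQ: "transpose Q = Q" using psd_cone_sym[OF Q] by (simp add: sym_mats_def)
  let ?P = "mat 1 - Q"
  have P_sym: "?P \<in> sym_mats"
    by (intro subspace_diff subspace_sym_mats mat_1_in_sym_mats psd_cone_sym Q)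
  have tP: "transpose ?P = ?P" using P_sym by (simp add: sym_mats_def)
  have PP: "?P ** ?P = ?P"
    by (simp add: matrix_mult_diff_left matrix_mult_diff_right QQ)
  have P_contr: "norm (?P *v v) \<le> norm v" for v
  proof -
    have "(norm (?P *v v))\<^sup>2 = v \<bullet> (?P *v v)"
      using sym_mats_self_adjoint[OF P_sym, of v "?P *v v"] PP
      by (simp add: matrix_vector_mul_assoc power2_norm_eq_inner)
    also have "\<dots> \<le> norm v * norm (?P *v v)" by (rule norm_cauchy_schwarz)
    finally show ?thesis
      by (cases "?P *v v = 0") (simp_all add: power2_eq_square)
  qed
  have "(infdist Y (complementary_face Z))\<^sup>2 \<le> 4 / c * norm Y * (Z \<bullet> Y)" if Y: "Y \<in> psd_cone" for Y
  proof -
    have tY: "transpose Y = Y" using psd_cone_sym[OF Y] by (simp add: sym_mats_def)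
    let ?W = "?P ** Y ** ?P"
    have "?W \<in> psd_cone"
    proof (rule psd_coneI)
      show "?W \<in> sym_mats"
        by (simp add: sym_mats_def matrix_transpose_mul tP tY matrix_mul_assoc)
      show "0 \<le> v \<bullet> (?W *v v)" for v
        using psd_cone_form_nonneg[OF Y, of "?P *v v"] sym_mats_self_adjoint[OF P_sym]
        by (simp add: matrix_vector_mul_assoc[symmetric])
    qed
    moreover have "?W \<bullet> Z = 0"
    proof -
      have "?W \<bullet> Z = (?P ** Y) \<bullet> (Z ** ?P)"
        by (simp only: inner_matrix_mult_right tP)
      also have "Z ** ?P = 0" by (simp add: matrix_mult_diff_right ZQ)
      finally show ?thesis by simp
    qed
    ultimately have "?W \<in> complementary_face Z" by (simp add: complementary_face_def)
    then have "infdist Y (complementary_face Z) \<le> norm (Y - ?W)"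
      using infdist_le dist_norm by metis
    also have "Y - ?W = Y ** Q + (Q ** Y) ** ?P"
      by (simp add: matrix_mult_diff_left matrix_mult_diff_right)
    also have "norm \<dots> \<le> norm (Y ** Q) + norm ((Q ** Y) ** ?P)"
      by (rule norm_triangle_ineq)
    also have "norm ((Q ** Y) ** ?P) \<le> norm (Q ** Y)"
      by (rule norm_mult_contraction_le[OF P_sym P_contr])
    also have "norm (Q ** Y) = norm (Y ** Q)"
      using norm_transpose[of "Q ** Y"] by (simp add: matrix_transpose_mul tQ tY)
    finally have "infdist Y (complementary_face Z) \<le> 2 * norm (Y ** Q)" by simp
    then have "(infdist Y (complementary_face Z))\<^sup>2 \<le> (2 * norm (Y ** Q))\<^sup>2"
      by (intro power_mono infdist_nonneg)
    also have "\<dots> = 4 * (norm (Y ** Q))\<^sup>2" by (simp add: power_mult_distrib)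
    also have "(norm (Y ** Q))\<^sup>2 = (Y ** Y) \<bullet> Q"
    proof -
      have "(norm (Y ** Q))\<^sup>2 = Y \<bullet> ((Y ** Q) ** Q)"
        by (simp only: power2_norm_eq_inner inner_matrix_mult_right tQ)
      also have "\<dots> = (Y ** Y) \<bullet> Q"
        by (simp only: matrix_mul_assoc[symmetric] QQ inner_matrix_mult_left tY)
      finally show ?thesis .
    qed
    finally have "(infdist Y (complementary_face Z))\<^sup>2 \<le> 4 * ((Y ** Y) \<bullet> Q)" .
    moreover have "(Y ** Y) \<bullet> Q \<le> norm Y * (Y \<bullet> Q)"
    proof -
      have "norm Y *\<^sub>R Y - Y ** Y \<in> psd_cone"
      proof (rule psd_coneI)
        show "norm Y *\<^sub>R Y - Y ** Y \<in> sym_mats"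
          by (intro subspace_diff subspace_scale subspace_sym_mats psd_cone_sym[OF Y] square_in_sym_mats)
        show "0 \<le> v \<bullet> ((norm Y *\<^sub>R Y - Y ** Y) *v v)" for v
          using psd_cone_norm_image_le[OF Y, of v] sym_mats_self_adjoint[OF psd_cone_sym[OF Y], of v "Y *v v"]
          by (simp add: matrix_vector_mult_diff_rdistrib inner_diff_right matrix_vector_mul_assoc[symmetric]
              power2_norm_eq_inner flip: scaleR_matrix_vector_assoc)
      qed
      from psd_cone_inner_nonneg[OF this Q] show ?thesis by (simp add: inner_diff_left)
    qed
    moreover have "norm Y * (Y \<bullet> Q) \<le> norm Y * ((Z \<bullet> Y) / c)"
    proof (rule mult_left_mono)
      show "Y \<bullet> Q \<le> (Z \<bullet> Y) / c"
        using psd_cone_inner_nonneg[OF c(2) Y] c(1)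
        by (simp add: inner_diff_left inner_commute[of Y Q] field_simps)
    qed simp
    ultimately have "(infdist Y (complementary_face Z))\<^sup>2 \<le> 4 * (norm Y * ((Z \<bullet> Y) / c))"
      by linarith
    then show ?thesis by (simp add: field_simps)
  qed
  then show ?thesis using that[of "4 / c"] c(1) by simp
qed

section \<open>Quadratic growth\<close>

text \<open>With \<open>Y = X + t I\<close>, the right-hand side equals \<open>(\<rho> - trace Z) t + Z \<bullet> Y\<close>, while the squared
  distance is at most \<open>a t + b (Z \<bullet> Y)\<close> with constants \<open>a\<close> and \<open>b\<close> that are uniform on the ball.\<close>

lemma penalty_quadratic_growth:
  fixes Z Xbar :: "real^'n^'n"
  assumes Z: "Z \<in> psd_cone" and \<rho>: "\<rho> > trace Z" and \<mu>: "\<mu> > 0"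
  obtains \<kappa> where "\<kappa> > 0"
    "\<And>X. X \<in> sym_mats \<Longrightarrow> dist Xbar X \<le> \<mu> \<Longrightarrow>
       \<kappa> * (infdist X (complementary_face Z))\<^sup>2 \<le> \<rho> * psd_deficit X + Z \<bullet> X"
proof -
  obtain C where C: "C > 0" "\<And>Y. Y \<in> psd_cone \<Longrightarrow>
      (infdist Y (complementary_face Z))\<^sup>2 \<le> C * norm Y * (Z \<bullet> Y)"
    using infdist_complementary_face_le[OF Z] by blast
  define N where "N = norm (mat 1 :: real^'n^'n)"
  define R where "R = norm Xbar + \<mu>"
  have N: "N \<ge> 0" by (simp add: N_def)
  have R: "R > 0" using \<mu> by (simp add: R_def add_nonneg_pos)
  define a where "a = 2 * N\<^sup>2 * R"
  define b where "b = 2 * (C * (R * (1 + N)))"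
  have a: "a \<ge> 0" and b: "b > 0" using N R C(1) by (simp_all add: a_def b_def)
  let ?\<sigma> = "\<rho> - trace Z"
  have \<sigma>: "?\<sigma> > 0" using \<rho> by simp
  define M where "M = a / ?\<sigma> + b"
  have M: "M > 0" using a b \<sigma> by (simp add: M_def add_nonneg_pos)
  have "1 / M * (infdist X (complementary_face Z))\<^sup>2 \<le> \<rho> * psd_deficit X + Z \<bullet> X"
    if X: "X \<in> sym_mats" and near: "dist Xbar X \<le> \<mu>" for X
  proof -
    define t where "t = psd_deficit X"
    define Y where "Y = X + t *\<^sub>R mat 1"
    have Y: "Y \<in> psd_cone" unfolding Y_def t_def by (rule shift_by_deficit_psd[OF X])
    have t: "0 \<le> t" by (simp add: t_def psd_deficit_nonneg)
    have normX: "norm X \<le> R"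
      using near norm_triangle_ineq2[of X Xbar] by (simp add: R_def dist_norm norm_minus_commute)
    then have tR: "t \<le> R" using psd_deficit_le_norm[OF X] by (simp add: t_def)
    have "norm Y \<le> norm X + t * N"
      unfolding Y_def N_def using norm_triangle_ineq[of X "t *\<^sub>R mat 1"] t by simp
    also have "\<dots> \<le> R + R * N" using normX tR N by (intro add_mono mult_right_mono)
    finally have normY: "norm Y \<le> R * (1 + N)" by (simp add: algebra_simps)
    have ZY: "0 \<le> Z \<bullet> Y" by (rule psd_cone_inner_nonneg[OF Z Y])
    let ?d = "infdist X (complementary_face Z)" and ?e = "infdist Y (complementary_face Z)"
    have "?d \<le> ?e + dist X Y" by (rule infdist_triangle)
    also have "dist X Y = t * N" using t by (simp add: Y_def dist_norm N_def)
    finally have "?d\<^sup>2 \<le> (?e + t * N)\<^sup>2" by (intro power_mono infdist_nonneg)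
    also have "\<dots> \<le> 2 * ?e\<^sup>2 + 2 * (t * N)\<^sup>2"
      using zero_le_power2[of "?e - t * N"] by (simp add: power2_eq_square algebra_simps)
    also have "2 * (t * N)\<^sup>2 \<le> a * t"
      using mult_right_mono[OF tR, of "2 * N\<^sup>2 * t"] t N by (simp add: a_def power2_eq_square mult_ac)
    also have "2 * ?e\<^sup>2 \<le> b * (Z \<bullet> Y)"
    proof -
      have "?e\<^sup>2 \<le> C * norm Y * (Z \<bullet> Y)" by (rule C(2)[OF Y])
      also have "\<dots> \<le> C * (R * (1 + N)) * (Z \<bullet> Y)"
        using normY C(1) ZY by (intro mult_right_mono mult_left_mono) auto
      finally show ?thesis by (simp add: b_def)
    qed
    finally have "?d\<^sup>2 \<le> b * (Z \<bullet> Y) + a * t" by simp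
    also have "\<dots> \<le> M * (Z \<bullet> Y) + (M * ?\<sigma>) * t"
    proof (intro add_mono mult_right_mono ZY t)
      show "b \<le> M" using a \<sigma> by (simp add: M_def)
      have "a = a / ?\<sigma> * ?\<sigma>" using \<sigma> by simp
      also have "\<dots> \<le> M * ?\<sigma>" using b \<sigma> by (intro mult_right_mono) (auto simp: M_def)
      finally show "a \<le> M * ?\<sigma>" .
    qed
    also have "\<dots> = M * (Z \<bullet> Y + ?\<sigma> * t)" by (simp add: algebra_simps)
    also have "Z \<bullet> Y + ?\<sigma> * t = \<rho> * t + Z \<bullet> X"
      using inner_shift_by_deficit[OF psd_cone_sym[OF Z], of X]
      by (simp add: Y_def t_def algebra_simps)
    finally show ?thesis using M by (simp add: t_def field_simps)
  qed
  then show ?thesis using that[of "1 / M"] M by simp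
qed

lemma penalty_le_indicator_psd: "penalty_fun \<rho> X \<le> indicator_fun psd_cone X"
  by (simp add: indicator_fun_def penalty_fun_eq_deficit psd_deficit_eq_0)

theorem lemma3:
  fixes Xbar Zbar :: "real^'n^'n"
    and l :: "real^'n^'n \<Rightarrow> ereal"
  assumes "Xbar \<in> psd_cone" and "Zbar \<in> psd_cone"
    and "Xbar \<bullet> Zbar = 0"
    and "l = indicator_fun psd_cone \<or> (\<exists>\<rho>. \<rho> > trace Zbar \<and> l = penalty_fun \<rho>)"
  shows "subdiff_inv l (- Zbar) = subdiff_inv (indicator_fun psd_cone) (- Zbar)
    \<and> subdiff_inv (indicator_fun psd_cone) (- Zbar) = normal_cone (polar_cone psd_cone) (- Zbar)
    \<and> (\<forall>\<mu>>0. \<exists>\<kappa>>0. \<forall>X \<in> sym_mats \<inter> cball Xbar \<mu>.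
          l X \<ge> l Xbar + ereal ((- Zbar) \<bullet> (X - Xbar))
                 + ereal (\<kappa> * (infdist X (subdiff_inv l (- Zbar)))\<^sup>2))"
proof -
  note Z = assms(2)
  \<comment> \<open>For the indicator function any \<open>\<rho>\<close> above the trace serves, so both cases reduce to the penalty.\<close>
  obtain \<rho> where \<rho>: "\<rho> > trace Zbar" and pen: "\<And>X. penalty_fun \<rho> X \<le> l X"
    using assms(4) penalty_le_indicator_psd by (metis gt_ex order_refl)
  have inv: "subdiff_inv l (- Zbar) = complementary_face Zbar"
    using assms(4) subdiff_inv_indicator_psd[OF Z] subdiff_inv_penalty[OF Z] by auto
  have l0: "l Xbar = 0"
    using assms(1,4) psd_deficit_eq_0[OF assms(1)]
    by (auto simp: indicator_fun_def penalty_fun_eq_deficit)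
  have "\<exists>\<kappa>>0. \<forall>X \<in> sym_mats \<inter> cball Xbar \<mu>. l X \<ge> l Xbar + ereal ((- Zbar) \<bullet> (X - Xbar))
      + ereal (\<kappa> * (infdist X (subdiff_inv l (- Zbar)))\<^sup>2)" if \<mu>: "\<mu> > 0" for \<mu>
  proof -
    obtain \<kappa> where \<kappa>: "\<kappa> > 0" and growth: "\<And>X. X \<in> sym_mats \<Longrightarrow> dist Xbar X \<le> \<mu> \<Longrightarrow>
        \<kappa> * (infdist X (complementary_face Zbar))\<^sup>2 \<le> \<rho> * psd_deficit X + Zbar \<bullet> X"
      using penalty_quadratic_growth[OF Z \<rho> \<mu>, of Xbar] by blast
    have "l Xbar + ereal ((- Zbar) \<bullet> (X - Xbar))
        + ereal (\<kappa> * (infdist X (subdiff_inv l (- Zbar)))\<^sup>2) \<le> l X"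
      if "X \<in> sym_mats \<inter> cball Xbar \<mu>" for X
    proof -
      have "l Xbar + ereal ((- Zbar) \<bullet> (X - Xbar))
          + ereal (\<kappa> * (infdist X (subdiff_inv l (- Zbar)))\<^sup>2) \<le> penalty_fun \<rho> X"
        unfolding inv l0 penalty_fun_eq_deficit using growth[of X] that assms(3)
        by (simp add: inner_diff_right inner_commute)
      then show ?thesis using pen order_trans by blast
    qed
    with \<kappa> show ?thesis by blast
  qed
  then show ?thesis
    unfolding inv subdiff_inv_indicator_psd[OF Z] normal_cone_polar_psd[OF Z] by blast
qed

end
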